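(* Let $A\in\mathbb{R}^{m\times n}$. Assume that $M=M^\mathsf{T}\in\mathbb{R}^{n\times n}$ is a nonsingular matrix such that $A^\mathsf{T}A=M-N$. Let $\ell\ge1$ be an integer, $H=M^{-1}N$, and $C^{(\ell)}=\sum_{i=0}^{\ell-1}H^iM^{-1}$. Assume that $M$ is definite if $\ell$ is odd, and that $M+N$ is definite if $\ell$ is even. Then each of the CGLS, LSQR, and LSMR methods preconditioned by $\ell$ steps of the inner iterations, i.e., with preconditioning matrix $C^{(\ell)}$, determines a solution of $\min_{\boldsymbol{x}\in\mathbb{R}^n}\|\boldsymbol{b}-A\boldsymbol{x}\|_2$ for all $\boldsymbol{b}\in\mathbb{R}^m$ and for all $\boldsymbol{x}_0\in\mathbb{R}^n$.
   Context: No rank or shape assumption is made on $A$. A symmetric matrix is definite if it is either positive definite or negative definite. $C^{(\ell)}$ is the matrix such that $C^{(\ell)}\boldsymbol{s}$ is the $\ell$th iterate of the stationary iteration $\boldsymbol{z}^{(j)}=H\boldsymbol{z}^{(j-1)}+M^{-1}\boldsymbol{s}$ with $\boldsymbol{z}^{(0)}=\boldsymbol{0}$. If $C^{(\ell)}$ is negative definite, the methods are understood with the sign changed, i.e., with $-C^{(\ell)}$ in place of $C^{(\ell)}$; write $C$ for the resulting positive definite matrix. Let $\boldsymbol{x}_0$ be the initial iterate, $\boldsymbol{s}_0=A^\mathsf{T}(\boldsymbol{b}-A\boldsymbol{x}_0)$, and $\mathcal{K}_k=\mathrm{span}\{C\boldsymbol{s}_0,(CA^\mathsf{T}A)C\boldsymbol{s}_0,\dots,(CA^\mathsf{T}A)^{k-1}C\boldsymbol{s}_0\}$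 (with $\mathcal{K}_0=\{\boldsymbol{0}\}$). Preconditioned CGLS and LSQR are both mathematically equivalent to preconditioned CG applied to the normal equations $A^\mathsf{T}A\boldsymbol{x}=A^\mathsf{T}\boldsymbol{b}$: the $k$th iterate is the $\boldsymbol{x}_k\in\boldsymbol{x}_0+\mathcal{K}_k$ minimizing $\|\boldsymbol{x}_k-\boldsymbol{x}_*\|_{A^\mathsf{T}A}=\|A(\boldsymbol{x}_k-\boldsymbol{x}_* )\|_2$, where $\boldsymbol{x}_*$ is any solution of the normal equations. Preconditioned LSMR is mathematically equivalent to preconditioned MINRES applied to the normal equations: the $k$th iterate is the $\boldsymbol{x}_k\in\boldsymbol{x}_0+\mathcal{K}_k$ minimizing $\|C^{\frac12}A^\mathsf{T}(\boldsymbol{b}-A\boldsymbol{x}_k)\|_2$. "Determines a solution" means: in exact arithmetic, there is some $k\ge0$ such that the iterate $\boldsymbol{x}_k$ is well defined and is a minimizer of $\|\boldsymbol{b}-A\boldsymbol{x}\|_2$. *)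

theory Defs
  imports "HOL-Analysis.Analysis"
begin

section \<open>Definite matrices, powers and square roots\<close>

definition pos_def :: "real^'n^'n \<Rightarrow> bool" where
  "pos_def B \<longleftrightarrow> transpose B = B \<and> (\<forall>x. x \<noteq> 0 \<longrightarrow> x \<bullet> (B *v x) > 0)"

definition neg_def :: "real^'n^'n \<Rightarrow> bool" where
  "neg_def B \<longleftrightarrow> transpose B = B \<and> (\<forall>x. x \<noteq> 0 \<longrightarrow> x \<bullet> (B *v x) < 0)"

definition definite :: "real^'n^'n \<Rightarrow> bool" where
  "definite B \<longleftrightarrow> pos_def B \<or> neg_def B"

text \<open>The library's power on type \<^typ>\<open>real^'n^'n\<close> is the entrywise one, hence a separate
  power with respect to the matrix product.\<close>

primrec mat_pow :: "real^'n^'n \<Rightarrow> nat \<Rightarrow> real^'n^'n" where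
  "mat_pow B 0 = mat 1"
| "mat_pow B (Suc i) = B ** mat_pow B i"

text \<open>The square root of a positive definite matrix; unspecified for other matrices.\<close>

definition mat_sqrt :: "real^'n^'n \<Rightarrow> real^'n^'n" where
  "mat_sqrt B = (THE R. pos_def R \<and> R ** R = B)"

section \<open>Inner iterations\<close>

primrec stationary_iter :: "real^'n^'n \<Rightarrow> real^'n^'n \<Rightarrow> real^'n \<Rightarrow> nat \<Rightarrow> real^'n" where
  "stationary_iter H M s 0 = 0"
| "stationary_iter H M s (Suc j) = H *v stationary_iter H M s j + matrix_inv M *v s"

definition inner_matrix :: "real^'n^'n \<Rightarrow> real^'n^'n \<Rightarrow> nat \<Rightarrow> real^'n^'n" where
  "inner_matrix H M l = (\<Sum>i<l. mat_pow H i ** matrix_inv M)"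

lemma inner_matrix_Suc:
  "inner_matrix H M (Suc l) = H ** inner_matrix H M l + matrix_inv M"
proof -
  have sum: "H ** (\<Sum>i<k. mat_pow H i ** matrix_inv M)
      = (\<Sum>i<k. H ** (mat_pow H i ** matrix_inv M))" for k
    by (induction k) (simp_all add: matrix_add_ldistrib)
  show ?thesis
    unfolding inner_matrix_def sum.lessThan_Suc_shift sum
    by (simp add: matrix_mul_assoc add.commute)
qed

lemma inner_matrix_stationary_iter:
  "inner_matrix H M l *v s = stationary_iter H M s l"
proof (induction l)
  case 0
  then show ?case by (simp add: inner_matrix_def)
next
  case (Suc l)
  then show ?case
    by (simp add: inner_matrix_Suc matrix_vector_mult_add_rdistrib
        flip: matrix_vector_mul_assoc)
qed

text \<open>The sign change for a negative definite matrix.\<close>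

definition preconditioner :: "real^'n^'n \<Rightarrow> real^'n^'n" where
  "preconditioner C = (if neg_def C then - C else C)"

section \<open>Preconditioned Krylov methods for least squares\<close>

definition krylov :: "real^'n^'m \<Rightarrow> real^'n^'n \<Rightarrow> real^'n \<Rightarrow> nat \<Rightarrow> (real^'n) set" where
  "krylov A C s k = span ((\<lambda>i. mat_pow (C ** (transpose A ** A)) i *v (C *v s)) ` {..<k})"

definition search_space ::
  "real^'n^'m \<Rightarrow> real^'n^'n \<Rightarrow> real^'m \<Rightarrow> real^'n \<Rightarrow> nat \<Rightarrow> (real^'n) set" where
  "search_space A C b x0 k = {x0 + d | d. d \<in> krylov A C (transpose A *v (b - A *v x0)) k}"

definition normal_solution :: "real^'n^'m \<Rightarrow> real^'m \<Rightarrow> real^'n \<Rightarrow> bool" where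
  "normal_solution A b x \<longleftrightarrow> (transpose A ** A) *v x = transpose A *v b"

definition least_squares_solution :: "real^'n^'m \<Rightarrow> real^'m \<Rightarrow> real^'n \<Rightarrow> bool" where
  "least_squares_solution A b x \<longleftrightarrow> is_arg_min (\<lambda>z. norm (b - A *v z)) (\<lambda>_. True) x"

text \<open>
  The following predicates say that \<open>x\<close> is a \<open>k\<close>th iterate of the method with right-hand side
  \<open>b\<close>, initial iterate \<open>x0\<close> and preconditioning matrix \<open>C\<close>. They are relations, so that
  existence and uniqueness of the iterate are part of what has to be proved; the methods make
  sense only for a positive definite \<open>C\<close>. In exact arithmetic CGLS and LSQR are two
  implementations of preconditioned CG on the normal equations, and LSMR is one of preconditioned
  MINRES on the normal equations.
\<close>

definition normal_cg_iterate ::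
  "real^'n^'m \<Rightarrow> real^'n^'n \<Rightarrow> real^'m \<Rightarrow> real^'n \<Rightarrow> nat \<Rightarrow> real^'n \<Rightarrow> bool" where
  "normal_cg_iterate A C b x0 k x \<longleftrightarrow> pos_def C \<and>
    (\<forall>xs. normal_solution A b xs \<longrightarrow>
      is_arg_min (\<lambda>y. norm (A *v (y - xs))) (\<lambda>y. y \<in> search_space A C b x0 k) x)"

definition normal_minres_iterate ::
  "real^'n^'m \<Rightarrow> real^'n^'n \<Rightarrow> real^'m \<Rightarrow> real^'n \<Rightarrow> nat \<Rightarrow> real^'n \<Rightarrow> bool" where
  "normal_minres_iterate A C b x0 k x \<longleftrightarrow> pos_def C \<and>
    is_arg_min (\<lambda>y. norm (mat_sqrt C *v (transpose A *v (b - A *v y))))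
      (\<lambda>y. y \<in> search_space A C b x0 k) x"

definition cgls_iterate ::
  "real^'n^'m \<Rightarrow> real^'n^'n \<Rightarrow> real^'m \<Rightarrow> real^'n \<Rightarrow> nat \<Rightarrow> real^'n \<Rightarrow> bool" where
  "cgls_iterate A C b x0 k x \<longleftrightarrow> normal_cg_iterate A C b x0 k x"

definition lsqr_iterate ::
  "real^'n^'m \<Rightarrow> real^'n^'n \<Rightarrow> real^'m \<Rightarrow> real^'n \<Rightarrow> nat \<Rightarrow> real^'n \<Rightarrow> bool" where
  "lsqr_iterate A C b x0 k x \<longleftrightarrow> normal_cg_iterate A C b x0 k x"

definition lsmr_iterate ::
  "real^'n^'m \<Rightarrow> real^'n^'n \<Rightarrow> real^'m \<Rightarrow> real^'n \<Rightarrow> nat \<Rightarrow> real^'n \<Rightarrow> bool" where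
  "lsmr_iterate A C b x0 k x \<longleftrightarrow> normal_minres_iterate A C b x0 k x"

text \<open>For some \<open>k\<close> the \<open>k\<close>th iterate is well defined (it exists and is unique) and it is a
  least-squares solution.\<close>

definition determines_solution ::
  "(nat \<Rightarrow> real^'n \<Rightarrow> bool) \<Rightarrow> real^'n^'m \<Rightarrow> real^'m \<Rightarrow> bool" where
  "determines_solution iterate A b \<longleftrightarrow>
    (\<exists>k x. iterate k x \<and> (\<forall>y. iterate k y \<longrightarrow> y = x) \<and> least_squares_solution A b x)"

end

theory Submission
  imports Defs
begin

text \<open>
  With \<open>W = M\<^sup>-\<^sup>1\<close> and \<open>C\<^sub>l\<close> the inner-iteration matrix, \<open>H W = W H\<^sup>T\<close> yields the two-step
  recursion \<open>C\<^bsub>l+2\<^esub> = H C\<^sub>l H\<^sup>T + W (M + N) W\<close>. For even \<open>l\<close> it makes \<open>C\<^sub>l\<close> definite like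
  \<open>M + N\<close>. For odd \<open>l\<close> it reads \<open>D\<^bsub>l+2\<^esub> = H D\<^sub>l H\<^sup>T + (I + H) W (I + H)\<^sup>T / 2\<close> in terms of
  \<open>D\<^sub>l = C\<^sub>l - W / 2\<close>, so that \<open>D\<^sub>l\<close> stays semidefinite with the sign of \<open>M\<close>.

  For positive definite \<open>C\<close> and \<open>G = A\<^sup>T A\<close>, the map \<open>C G\<close> is injective on its range. The Krylov
  spaces stabilise at a \<open>C G\<close>-invariant subspace of that range, on which \<open>C G\<close> is hence bijective.
  So this space contains exactly one \<open>d\<close> with \<open>G d = s\<^sub>0\<close>, and at \<open>x\<^sub>0 + d\<close> both minimised
  quantities vanish. For LSMR this determines the iterate because \<open>C\<close> has exactly one positive
  definite square root, which the spectral theorem provides.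
\<close>

section \<open>Symmetric matrices and their square roots\<close>

lemma inner_matrix_vector_transpose:
  fixes A :: "real^'n^'m"
  shows "x \<bullet> (A *v y) = (transpose A *v x) \<bullet> y"
  by (simp add: dot_lmul_matrix)

lemma symmetric_matrix_inner:
  fixes B :: "real^'n^'n"
  assumes "transpose B = B"
  shows "x \<bullet> (B *v y) = (B *v x) \<bullet> y"
  using inner_matrix_vector_transpose[of x B y] assms by simp

lemma symmetric_matrixI:
  fixes B :: "real^'n^'n"
  assumes "\<And>x y. x \<bullet> (B *v y) = (B *v x) \<bullet> y"
  shows "transpose B = B"
proof -
  have "(transpose B *v x - B *v x) \<bullet> y = 0" for x y
    using inner_matrix_vector_transpose[of x B y] assms[of x y] by (simp add: inner_diff_left)
  then have "transpose B *v x - B *v x = 0" for x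
    using inner_eq_zero_iff by blast
  then show ?thesis
    by (simp only: matrix_eq right_minus_eq) simp
qed

lemma matrix_mult_minus_left: "(- B) ** C = - (B ** (C :: real^'p^'n))"
  by (simp add: vec_eq_iff matrix_matrix_mult_def sum_negf)

lemma matrix_mult_minus_right: "B ** (- C) = - (B ** (C :: real^'p^'n))"
  by (simp add: vec_eq_iff matrix_matrix_mult_def sum_negf)

lemma matrix_vector_mult_minus_left: "(- B) *v x = - (B *v (x :: real^'n))"
  by (simp add: vec_eq_iff matrix_vector_mult_def sum_negf)

lemma transpose_minus: "transpose (- B) = - transpose (B :: real^'n^'m)"
  by (simp add: vec_eq_iff transpose_def)

lemma transpose_add: "transpose (B + C) = transpose B + transpose (C :: real^'n^'m)"
  by (simp add: vec_eq_iff transpose_def)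

lemma neg_def_iff_pos_def_minus: "neg_def B \<longleftrightarrow> pos_def (- B)"
  by (simp add: neg_def_def pos_def_def transpose_minus matrix_vector_mult_minus_left)

text \<open>This guarantees that \<open>preconditioner\<close> leaves a positive definite matrix
  unchanged.\<close>

lemma pos_def_not_neg_def:
  assumes "pos_def (B :: real^'n^'n)"
  shows "\<not> neg_def B"
proof
  assume "neg_def B"
  moreover obtain x :: "real^'n" where "x \<noteq> 0"
    using zero_neq_one by metis
  ultimately show False
    using assms unfolding pos_def_def neg_def_def by (meson less_asym)
qed

lemma pos_def_injective:
  assumes "pos_def B" "B *v x = 0"
  shows "x = 0"
proof (rule ccontr)
  assume "x \<noteq> 0"
  then have "0 < x \<bullet> (B *v x)" using assms(1) unfolding pos_def_def by blast
  then show False using assms(2) by simp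
qed

section \<open>Spectral theorem for self-adjoint maps\<close>

lemma nonneg_quadratic_linear_coeff_zero:
  fixes a c :: real
  assumes "\<And>t. 0 \<le> 2 * t * a + t\<^sup>2 * c" "0 \<le> c"
  shows "a = 0"
proof (rule ccontr)
  assume "a \<noteq> 0"
  have "2 * (- a / (c + 1)) * a + (- a / (c + 1))\<^sup>2 * c = - (a\<^sup>2 * (c + 2)) / (c + 1)\<^sup>2"
    using assms(2) by (simp add: divide_simps power2_eq_square) algebra
  also have "\<dots> < 0"
    using assms(2) \<open>a \<noteq> 0\<close> by (simp add: divide_simps)
  finally show False
    using assms(1)[of "- a / (c + 1)"] by linarith
qed

text \<open>Maximise the Rayleigh quotient over the unit sphere of \<open>W\<close>. With
  \<open>c\<close> the maximum, the form \<open>c * (y . y) - y . f y\<close> is nonnegative on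
  \<open>W\<close> and vanishes at the maximiser \<open>x\<close>. Moving from \<open>x\<close>
  along the residual \<open>w = c x - f x\<close> gives a nonnegative quadratic in \<open>t\<close>
  without constant term, whose linear coefficient \<open>2 * (w . w)\<close> must therefore
  vanish.\<close>

lemma selfadjoint_invariant_eigenvector:
  fixes f :: "'a::euclidean_space \<Rightarrow> 'a"
  assumes f: "linear f" and sa: "\<And>x y. x \<bullet> f y = f x \<bullet> y"
    and W: "subspace W" "\<And>x. x \<in> W \<Longrightarrow> f x \<in> W" and z: "z \<in> W" "z \<noteq> 0"
  obtains x c where "x \<in> W" "norm x = 1" "f x = c *\<^sub>R x"
proof -
  let ?S = "sphere 0 1 \<inter> W"
  have "compact ?S"
    using compact_Int_closed[OF compact_sphere closed_subspace[OF W(1)]] .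
  moreover have "z /\<^sub>R norm z \<in> ?S"
    using z W(1) by (simp add: subspace_scale)
  then have "?S \<noteq> {}" by blast
  moreover have "continuous_on ?S (\<lambda>x. x \<bullet> f x)"
    by (intro continuous_intros linear_continuous_on linear_linear[THEN iffD2] f)
  ultimately obtain x where x: "x \<in> ?S" and max: "\<And>y. y \<in> ?S \<Longrightarrow> y \<bullet> f y \<le> x \<bullet> f x"
    using continuous_attains_sup[of ?S "\<lambda>x. x \<bullet> f x"] by blast
  define c where "c = x \<bullet> f x"
  define w where "w = c *\<^sub>R x - f x"
  have ray: "y \<bullet> f y \<le> c * (y \<bullet> y)" if "y \<in> W" for y
  proof (cases "y = 0")
    case False
    then have "y /\<^sub>R norm y \<in> ?S"
      using that W(1) by (simp add: subspace_scale)
    from max[OF this] have "(y \<bullet> f y) / (norm y)\<^sup>2 \<le> c"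
      by (simp add: linear_scale[OF f] c_def power2_eq_square divide_simps)
    then show ?thesis
      using False by (simp add: divide_simps power2_norm_eq_inner)
  qed (simp add: linear_0[OF f])
  have xW: "x \<in> W" and xx: "x \<bullet> x = 1"
    using x by (auto simp: norm_eq_1)
  have wW: "w \<in> W"
    unfolding w_def using W xW by (simp add: subspace_diff subspace_scale)
  have "0 \<le> 2 * t * (w \<bullet> w) + t\<^sup>2 * (c * (w \<bullet> w) - w \<bullet> f w)" for t
  proof -
    have fx: "f x = c *\<^sub>R x - w" by (simp add: w_def)
    have xfw: "x \<bullet> f w = c * (x \<bullet> w) - w \<bullet> w"
      using sa[of x w] by (simp add: fx inner_diff_left)
    have "x \<bullet> f x = c" by (simp add: c_def)
    then have xw: "x \<bullet> w = 0"
      by (simp add: fx inner_diff_right xx)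
    have "0 \<le> c * ((x + t *\<^sub>R w) \<bullet> (x + t *\<^sub>R w)) - (x + t *\<^sub>R w) \<bullet> f (x + t *\<^sub>R w)"
      using ray[of "x + t *\<^sub>R w"] xW wW W(1) by (simp add: subspace_add subspace_scale)
    also have "\<dots> = 2 * t * (w \<bullet> w) + t\<^sup>2 * (c * (w \<bullet> w) - w \<bullet> f w)"
      using xw inner_commute[of w x]
      by (simp add: linear_add[OF f] linear_scale[OF f] inner_add_left inner_add_right
          fx inner_diff_right xfw xx power2_eq_square algebra_simps)
    finally show ?thesis .
  qed
  then have "w \<bullet> w = 0"
    by (rule nonneg_quadratic_linear_coeff_zero) (use ray[OF wW] in simp)
  then have "f x = c *\<^sub>R x" by (simp add: w_def)
  moreover have "norm x = 1" using xx by (simp add: norm_eq_1)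
  ultimately show ?thesis using that xW by blast
qed

text \<open>An orthonormal set of eigenvectors of maximal cardinality replaces induction on the
  dimension. If it did not span, its orthogonal complement would be nonzero and
  \<open>f\<close>-invariant by self-adjointness, hence contain one more eigenvector.\<close>

lemma selfadjoint_orthonormal_eigenbasis:
  fixes f :: "'a::euclidean_space \<Rightarrow> 'a"
  assumes f: "linear f" and sa: "\<And>x y. x \<bullet> f y = f x \<bullet> y"
  obtains F c where "finite F" "pairwise orthogonal F" "\<And>v. v \<in> F \<Longrightarrow> norm v = 1"
    "span F = UNIV" "\<And>v. v \<in> F \<Longrightarrow> f v = c v *\<^sub>R v"
proof -
  define P where "P F \<longleftrightarrow> pairwise orthogonal F \<and> (\<forall>v\<in>F. norm v = 1 \<and> (\<exists>c. f v = c *\<^sub>R v))" for F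
  have ind: "independent F" if "P F" for F
    using that unfolding P_def by (intro pairwise_orthogonal_independent) auto
  have "P {}" by (simp add: P_def)
  moreover have "\<forall>F. P F \<longrightarrow> card F < DIM('a) + 1"
    using ind independent_bound by (metis less_Suc_eq_le Suc_eq_plus1)
  ultimately obtain F where F: "P F" and max: "\<And>F'. P F' \<Longrightarrow> card F' \<le> card F"
    using ex_has_greatest_nat[of P "{}" card] by blast
  have fin: "finite F" using ind[OF F] by (rule finiteI_independent)
  have span: "span F = UNIV"
  proof (rule ccontr)
    assume "span F \<noteq> UNIV"
    then obtain a where "a \<notin> span F" by blast
    obtain y z where yz: "y \<in> span F" "\<And>w. w \<in> span F \<Longrightarrow> orthogonal z w" "a = y + z"
      using orthogonal_subspace_decomp_exists by blast
    then have "z \<noteq> 0" using \<open>a \<notin> span F\<close> by auto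
    let ?W = "{y. \<forall>x \<in> F. orthogonal x y}"
    have inv: "f x \<in> ?W" if "x \<in> ?W" for x
    proof clarify
      fix v assume "v \<in> F"
      then obtain c where "f v = c *\<^sub>R v" using F unfolding P_def by blast
      then show "orthogonal v (f x)"
        using that \<open>v \<in> F\<close> by (simp add: orthogonal_def sa)
    qed
    have "z \<in> ?W" using yz(2) by (simp add: span_base orthogonal_commute)
    from selfadjoint_invariant_eigenvector[OF f sa subspace_orthogonal_to_vectors inv this \<open>z \<noteq> 0\<close>]
    obtain x c where x: "x \<in> ?W" "norm x = 1" "f x = c *\<^sub>R x" by blast
    have "x \<notin> F"
      using x by (auto simp: orthogonal_def)
    moreover have "P (insert x F)"
      using F x unfolding P_def by (auto simp: pairwise_insert orthogonal_commute)
    ultimately show False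
      using max[of "insert x F"] fin by simp
  qed
  have "\<forall>v\<in>F. \<exists>c. f v = c *\<^sub>R v" using F unfolding P_def by blast
  then obtain c where "\<And>v. v \<in> F \<Longrightarrow> f v = c v *\<^sub>R v" by metis
  then show ?thesis using that fin span F unfolding P_def by blast
qed

section \<open>The positive definite square root\<close>

lemma pos_def_sqrt_exists:
  fixes B :: "real^'n^'n"
  assumes B: "pos_def B"
  obtains R where "pos_def R" "R ** R = B"
proof -
  have "x \<bullet> (B *v y) = (B *v x) \<bullet> y" for x y
    using B symmetric_matrix_inner unfolding pos_def_def by blast
  from selfadjoint_orthonormal_eigenbasis[OF matrix_vector_mul_linear this]
  obtain F c where F: "finite F" "pairwise orthogonal F" "\<And>v. v \<in> F \<Longrightarrow> norm v = 1"
    "span F = UNIV" and c: "\<And>v. v \<in> F \<Longrightarrow> B *v v = c v *\<^sub>R v" by blast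
  have cpos: "c v > 0" if "v \<in> F" for v
  proof -
    have "v \<noteq> 0" using F(3)[OF that] by auto
    then have "0 < v \<bullet> (B *v v)" using B unfolding pos_def_def by blast
    then show ?thesis using c[OF that] F(3)[OF that] by (simp add: norm_eq_1)
  qed
  \<comment> \<open>Functional calculus: the component of \<open>x\<close> along each eigenvector
    \<open>v\<close> is scaled by the square root of its eigenvalue.\<close>
  define g where "g x = (\<Sum>v\<in>F. (sqrt (c v) * (v \<bullet> x)) *\<^sub>R v)" for x
  have lin: "linear g"
    unfolding g_def
    by (intro linearI)
      (simp_all add: inner_add_right distrib_left scaleR_add_left sum.distrib scaleR_sum_right
        mult.left_commute)
  have Rg: "matrix g *v x = g x" for x
    using matrix_works[of g] lin by simp
  have gv: "g v = sqrt (c v) *\<^sub>R v" if "v \<in> F" for v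
  proof -
    have "(sqrt (c u) * (u \<bullet> v)) *\<^sub>R u = (if u = v then sqrt (c v) *\<^sub>R v else 0)" if "u \<in> F" for u
      using F(2) F(3)[OF that] that \<open>v \<in> F\<close>
      by (auto simp: pairwise_def orthogonal_def norm_eq_1)
    then show ?thesis
      unfolding g_def using that F(1) by simp
  qed
  have sym: "x \<bullet> g y = (\<Sum>v\<in>F. sqrt (c v) * (v \<bullet> x) * (v \<bullet> y))" for x y
    unfolding g_def by (simp add: inner_sum_right inner_commute algebra_simps)
  have "transpose (matrix g) = matrix g"
  proof (rule symmetric_matrixI)
    show "x \<bullet> (matrix g *v y) = (matrix g *v x) \<bullet> y" for x y
      using sym[of x y] sym[of y x] by (simp add: Rg inner_commute mult_ac)
  qed
  moreover have "x \<bullet> g x > 0" if "x \<noteq> 0" for x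
  proof -
    have "\<exists>v\<in>F. v \<bullet> x \<noteq> 0"
    proof (rule ccontr)
      assume "\<not> ?thesis"
      then have "orthogonal x x"
        using orthogonal_to_span[of x F x] F(4) by (auto simp: orthogonal_def inner_commute)
      then show False using that by (simp add: orthogonal_def)
    qed
    then obtain v where v: "v \<in> F" "v \<bullet> x \<noteq> 0" by blast
    show ?thesis
      unfolding sym
    proof (rule sum_pos2[OF F(1) v(1)])
      show "0 < sqrt (c v) * (v \<bullet> x) * (v \<bullet> x)"
        using cpos[OF v(1)] v(2) by (auto simp: mult.assoc zero_less_mult_iff)
      show "0 \<le> sqrt (c u) * (u \<bullet> x) * (u \<bullet> x)" if "u \<in> F" for u
        using cpos[OF that] by (simp add: mult.assoc)
    qed
  qed
  ultimately have "pos_def (matrix g)"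
    by (simp add: pos_def_def Rg)
  moreover have "matrix g ** matrix g = B"
    unfolding matrix_eq
  proof
    fix x :: "real^'n"
    show "(matrix g ** matrix g) *v x = B *v x"
    proof (rule linear_eq_on[of "\<lambda>x. (matrix g ** matrix g) *v x" "\<lambda>x. B *v x" x F])
      fix v assume "v \<in> F"
      then show "(matrix g ** matrix g) *v v = B *v v"
        using cpos[OF \<open>v \<in> F\<close>]
        by (simp add: c gv Rg linear_scale[OF lin] flip: matrix_vector_mul_assoc)
    qed (use F(4) in \<open>auto simp: matrix_vector_mul_linear\<close>)
  qed
  ultimately show ?thesis using that by blast
qed

text \<open>Diagonalise the difference \<open>R - S\<close>, which avoids any commutation argument.
  At an eigenvector \<open>v\<close> with eigenvalue \<open>c\<close>, equal squares give
  \<open>0 = |R v|^2 - |S v|^2 = c * (v . R v + v . S v)\<close>, and the bracket is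
  positive.\<close>

lemma pos_def_sqrt_unique:
  fixes R S :: "real^'n^'n"
  assumes R: "pos_def R" and S: "pos_def S" and eq: "R ** R = S ** S"
  shows "R = S"
proof -
  have symR: "x \<bullet> (R *v y) = (R *v x) \<bullet> y" and symS: "x \<bullet> (S *v y) = (S *v x) \<bullet> y" for x y
    using R S symmetric_matrix_inner unfolding pos_def_def by blast+
  define f where "f x = R *v x - S *v x" for x
  have lin: "linear f"
    unfolding f_def by (intro linear_compose_sub matrix_vector_mul_linear)
  have "x \<bullet> f y = f x \<bullet> y" for x y
    by (simp add: f_def inner_diff_left inner_diff_right symR symS)
  from selfadjoint_orthonormal_eigenbasis[OF lin this]
  obtain F c where "finite F" "pairwise orthogonal F"
    and F: "\<And>v. v \<in> F \<Longrightarrow> norm v = 1" "span F = UNIV"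
    and c: "\<And>v. v \<in> F \<Longrightarrow> f v = c v *\<^sub>R v" by blast
  have "R *v v = S *v v" if "v \<in> F" for v
  proof -
    have "v \<noteq> 0" using F(1)[OF that] by auto
    then have pos: "v \<bullet> (R *v v) + v \<bullet> (S *v v) > 0"
      using R S unfolding pos_def_def by (simp add: add_pos_pos)
    have Rv: "R *v v = S *v v + c v *\<^sub>R v" using c[OF that] by (simp add: f_def algebra_simps)
    have "R *v (R *v v) = S *v (S *v v)"
      using eq by (simp add: matrix_vector_mul_assoc)
    then have "(R *v v) \<bullet> (R *v v) = (S *v v) \<bullet> (S *v v)"
      using symR[of v "R *v v"] symS[of v "S *v v"] by simp
    moreover have "(R *v v) \<bullet> (R *v v) - (S *v v) \<bullet> (S *v v)
        = c v * (v \<bullet> (R *v v) + v \<bullet> (S *v v))"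
      unfolding Rv by (simp add: inner_add_left inner_add_right inner_commute algebra_simps)
    ultimately have "c v = 0" using pos by simp
    then show ?thesis using Rv by simp
  qed
  then have "R *v x = S *v x" for x
    using linear_eq_on[of "\<lambda>x. R *v x" "\<lambda>x. S *v x" x F] F(2)
    by (simp add: matrix_vector_mul_linear)
  then show ?thesis by (simp add: matrix_eq)
qed

lemma pos_def_mat_sqrt:
  assumes "pos_def B"
  shows "pos_def (mat_sqrt B)"
proof -
  obtain R where R: "pos_def R" "R ** R = B"
    using pos_def_sqrt_exists[OF assms] .
  have "mat_sqrt B = R"
    unfolding mat_sqrt_def
  proof (rule the_equality)
    show "S = R" if "pos_def S \<and> S ** S = B" for S
      using pos_def_sqrt_unique[of S R] that R by simp
  qed (use R in simp)
  then show ?thesis using R by simp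
qed

section \<open>Definiteness of the inner-iteration matrix\<close>

lemma matrix_inv_inverse:
  assumes "invertible (B :: real^'n^'n)"
  shows "B ** matrix_inv B = mat 1 \<and> matrix_inv B ** B = mat 1"
  using assms unfolding matrix_inv_def invertible_def by (rule someI_ex)

lemma matrix_inv_unique:
  fixes B C :: "real^'n^'n"
  assumes "B ** C = mat 1"
  shows "matrix_inv B = C"
proof -
  have CB: "C ** B = mat 1"
    using assms by (simp add: matrix_left_right_inverse)
  then have "invertible B"
    using assms unfolding invertible_def by blast
  then have "matrix_inv B ** B = mat 1"
    using matrix_inv_inverse by blast
  then show ?thesis
    by (metis assms matrix_mul_assoc matrix_mul_lid matrix_mul_rid)
qed

lemma matrix_inv_minus:
  fixes M :: "real^'n^'n"
  assumes "invertible M"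
  shows "matrix_inv (- M) = - matrix_inv M"
  using matrix_inv_inverse[OF assms]
  by (intro matrix_inv_unique) (simp add: matrix_mult_minus_left matrix_mult_minus_right)

text \<open>\<open>H\<close> stays fixed because changing the signs of both \<open>M\<close> and
  \<open>N\<close> does not affect it. This reduces the negative definite case to the positive
  definite one.\<close>

lemma inner_matrix_minus:
  assumes "invertible M"
  shows "inner_matrix H (- M) l = - inner_matrix H M l"
  by (simp add: inner_matrix_def matrix_inv_minus[OF assms] matrix_mult_minus_right sum_negf)

lemma inner_matrix_0: "inner_matrix H M 0 = 0"
  by (simp add: inner_matrix_def)

lemma matrix_add_rdistrib: "(B + C) ** D = B ** D + C ** (D :: real^'p^'n)"
  by (simp add: vec_eq_iff matrix_matrix_mult_def distrib_right sum.distrib)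

text \<open>The commutation turns \<open>H^i W\<close> into \<open>W (H^T)^i\<close>, so a factor
  can be split off on the right as well. One step on each side produces the congruence
  \<open>H C H^T\<close>, which preserves semidefiniteness.\<close>

lemma inner_matrix_Suc_right:
  assumes "H ** matrix_inv M = matrix_inv M ** transpose H"
  shows "inner_matrix H M (Suc l) = inner_matrix H M l ** transpose H + matrix_inv M"
proof (induction l)
  case (Suc l)
  have "inner_matrix H M (Suc (Suc l)) = H ** inner_matrix H M (Suc l) + matrix_inv M"
    by (rule inner_matrix_Suc)
  also have "\<dots> = (H ** inner_matrix H M l + matrix_inv M) ** transpose H + matrix_inv M"
    by (simp add: Suc assms matrix_add_ldistrib matrix_add_rdistrib matrix_mul_assoc)
  finally show ?case by (simp add: inner_matrix_Suc[of H M l])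
qed (simp add: inner_matrix_def)

lemma transpose_inner_matrix:
  assumes "H ** matrix_inv M = matrix_inv M ** transpose H"
    and "transpose (matrix_inv M) = matrix_inv M"
  shows "transpose (inner_matrix H M l) = inner_matrix H M l"
proof (induction l)
  case 0
  show ?case by (simp add: inner_matrix_def transpose_def vec_eq_iff)
next
  case (Suc l)
  have "transpose (inner_matrix H M (Suc l)) = inner_matrix H M l ** transpose H + matrix_inv M"
    by (simp add: inner_matrix_Suc transpose_add matrix_transpose_mul assms(2) Suc)
  then show ?case by (simp only: inner_matrix_Suc_right[OF assms(1)])
qed

lemma inner_matrix_two_step_inner:
  fixes x :: "real^'n"
  assumes "H ** matrix_inv M = matrix_inv M ** transpose H"
  shows "x \<bullet> (inner_matrix H M (Suc (Suc l)) *v x) =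
    (transpose H *v x) \<bullet> (inner_matrix H M l *v (transpose H *v x))
    + x \<bullet> (matrix_inv M *v (transpose H *v x)) + x \<bullet> (matrix_inv M *v x)"
  unfolding inner_matrix_Suc[of H M "Suc l"] inner_matrix_Suc_right[OF assms, of l]
  by (simp add: matrix_vector_mult_add_rdistrib matrix_add_ldistrib inner_add_right
      inner_matrix_vector_transpose[of x H] assms
      del: transpose_matrix_vector flip: matrix_vector_mul_assoc)

section \<open>Definiteness by parity of the number of inner steps\<close>

lemma pos_def_inner_matrix:
  fixes M N H :: "real^'n^'n"
  assumes M: "transpose M = M" "invertible M" and N: "transpose N = N"
    and H: "H = matrix_inv M ** N" and l: "l \<ge> 1"
    and odd: "odd l \<Longrightarrow> pos_def M" and even: "even l \<Longrightarrow> pos_def (M + N)"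
  shows "pos_def (inner_matrix H M l)"
proof -
  define W where "W = matrix_inv M"
  have WM: "W ** M = mat 1" and MW: "M ** W = mat 1"
    unfolding W_def using matrix_inv_inverse[OF M(2)] by simp_all
  have WT: "transpose W = W"
  proof -
    have "M ** transpose W = mat 1"
      using arg_cong[OF WM, of transpose] M(1) by (simp add: matrix_transpose_mul)
    from matrix_inv_unique[OF this] show ?thesis by (simp add: W_def)
  qed
  have HT: "transpose H = N ** W"
    by (simp add: H matrix_transpose_mul N WT flip: W_def)
  have comm: "H ** matrix_inv M = matrix_inv M ** transpose H"
    unfolding HT by (simp add: H matrix_mul_assoc flip: W_def)
  note step = inner_matrix_two_step_inner[OF comm, folded W_def]
  have MWx: "M *v (W *v x) = x" for x
    by (simp add: MW matrix_vector_mul_assoc)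
  then have W0: "W *v x \<noteq> 0" if "x \<noteq> 0" for x
    using that by (metis matrix_vector_mult_0_right)
  have Wsym: "x \<bullet> (W *v y) = (W *v x) \<bullet> y" for x y
    using symmetric_matrix_inner[OF WT] .
  have "x \<bullet> (inner_matrix H M l *v x) > 0" if "x \<noteq> 0" for x
  proof (cases "even l")
    case True
    then have MN: "0 < y \<bullet> (M *v y) + y \<bullet> (N *v y)" if "y \<noteq> 0" for y
      using even that unfolding pos_def_def
      by (simp add: matrix_vector_mult_add_rdistrib inner_add_right)
    \<comment> \<open>With \<open>y = W x\<close> one has \<open>x = M y\<close> and
      \<open>H^T x = N y\<close>, so the increment is the quadratic form of \<open>M + N\<close> at
      \<open>y\<close>.\<close>
    have pos: "0 < x \<bullet> (W *v (transpose H *v x)) + x \<bullet> (W *v x)" if "x \<noteq> 0" for x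
      using MN[OF W0[OF that]] Wsym[of x "N *v (W *v x)"]
      by (simp add: HT MWx inner_commute del: transpose_matrix_vector
          flip: matrix_vector_mul_assoc)
    \<comment> \<open>The recursion starts from the zero matrix, so the induction carries only
      semidefiniteness; strictness comes from the last two-step increment, which exists because an
      even \<open>l >= 1\<close> is at least 2.\<close>
    have nn: "0 \<le> x \<bullet> (inner_matrix H M (2 * k) *v x)" for k x
    proof (induction k arbitrary: x)
      case (Suc k)
      show ?case
        using Suc[of "transpose H *v x"] pos[of x] step[of x "2 * k"]
        by (cases "x = 0") auto
    qed (simp add: inner_matrix_0)
    obtain k where "l = Suc (Suc (2 * k))"
    proof -
      obtain j where j: "l = 2 * j" using True by blast
      then have "l = Suc (Suc (2 * (j - 1)))" using l by simp
      then show ?thesis by (rule that)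
    qed
    then show ?thesis
      using nn[of "transpose H *v x" k] pos[OF that] step[of x "2 * k"] by simp
  next
    case False
    have Wpos: "0 < x \<bullet> (W *v x)" if "x \<noteq> 0" for x
    proof -
      have "0 < (W *v x) \<bullet> (M *v (W *v x))"
        using odd[OF False] W0[OF that] unfolding pos_def_def by blast
      then show ?thesis by (simp add: MWx inner_commute)
    qed
    then have Wnn: "0 \<le> x \<bullet> (W *v x)" for x
      by (cases "x = 0") (auto intro: less_imp_le)
    \<comment> \<open>This is twice the statement that \<open>C - W / 2\<close> is positive
      semidefinite. In the induction step, the hypothesis at \<open>y = H^T x\<close> leaves exactly
      the form of \<open>W\<close> at \<open>x + y\<close> to be nonnegative.\<close>
    have nn: "x \<bullet> (W *v x) \<le> 2 * (x \<bullet> (inner_matrix H M (Suc (2 * k)) *v x))" for k x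
    proof (induction k arbitrary: x)
      case 0
      show ?case
        using Wnn[of x] by (simp add: inner_matrix_Suc inner_matrix_0 flip: W_def)
    next
      case (Suc k)
      define y where "y = transpose H *v x"
      have "0 \<le> x \<bullet> (W *v x) + 2 * (x \<bullet> (W *v y)) + y \<bullet> (W *v y)"
        using Wnn[of "x + y"] Wsym[of x y]
        by (simp add: matrix_vector_right_distrib inner_add_left inner_add_right inner_commute)
      then show ?case
        using Suc[of y] step[of x "Suc (2 * k)", folded y_def] by simp
    qed
    obtain k where "l = Suc (2 * k)"
      using False by (elim oddE) simp
    then show ?thesis
      using nn[of x k] Wpos[OF that] by simp
  qed
  then show ?thesis
    unfolding pos_def_def using transpose_inner_matrix[OF comm] WT by (simp add: W_def)
qed

text \<open>In the negative definite case the previous result applies to \<open>- M\<close> and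
  \<open>- N\<close>, which have the same \<open>H\<close>. It makes the negated inner-iteration
  matrix positive definite, and that is the one \<open>preconditioner\<close> selects.\<close>

lemma pos_def_preconditioner_inner_matrix:
  fixes M N H :: "real^'n^'n"
  assumes M: "transpose M = M" "invertible M" and N: "transpose N = N"
    and H: "H = matrix_inv M ** N" and l: "l \<ge> 1"
    and odd: "odd l \<Longrightarrow> definite M" and even: "even l \<Longrightarrow> definite (M + N)"
  shows "pos_def (preconditioner (inner_matrix H M l))"
proof (cases "pos_def (if odd l then M else M + N)")
  case True
  then have "pos_def (inner_matrix H M l)"
    using pos_def_inner_matrix[OF M N H l] by (simp split: if_splits)
  then show ?thesis
    by (simp add: preconditioner_def pos_def_not_neg_def)
next
  case False
  then have neg: "neg_def (if odd l then M else M + N)"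
    using odd even by (auto simp: definite_def)
  have "invertible (- M)"
    using M(2) unfolding invertible_def
    by (metis matrix_mult_minus_left matrix_mult_minus_right minus_minus)
  then have "pos_def (inner_matrix H (- M) l)"
    using neg M N l H
    by (intro pos_def_inner_matrix[of "- M" "- N"])
      (auto simp: transpose_minus matrix_inv_minus matrix_mult_minus_left matrix_mult_minus_right
        neg_def_iff_pos_def_minus)
  then show ?thesis
    using M(2) by (simp add: inner_matrix_minus neg_def_iff_pos_def_minus preconditioner_def)
qed

section \<open>Krylov methods on the normal equations\<close>

lemma gram_eq_0_iff:
  fixes A :: "real^'n^'m"
  shows "(transpose A ** A) *v x = 0 \<longleftrightarrow> A *v x = 0"
proof
  assume "(transpose A ** A) *v x = 0"
  then have "x \<bullet> (transpose A *v (A *v x)) = 0"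
    by (simp add: matrix_vector_mul_assoc)
  then show "A *v x = 0"
    using inner_matrix_vector_transpose[of x "transpose A" "A *v x"] by simp
qed (simp flip: matrix_vector_mul_assoc)

text \<open>Project \<open>b\<close> onto the range of \<open>A\<close>. The remainder
  \<open>z\<close> is orthogonal to \<open>A (A^T z)\<close>, so \<open>|A^T z|^2 = 0\<close>; no
  rank condition enters.\<close>

lemma normal_solution_exists:
  fixes A :: "real^'n^'m"
  obtains x where "normal_solution A b x"
proof -
  obtain y z where yz: "y \<in> span (range (\<lambda>x. A *v x))"
    "\<And>w. w \<in> span (range (\<lambda>x. A *v x)) \<Longrightarrow> orthogonal z w" "b = y + z"
    using orthogonal_subspace_decomp_exists by blast
  have "span (range (\<lambda>x. A *v x)) = range (\<lambda>x. A *v x)"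
    by (simp add: linear_subspace_image matrix_vector_mul_linear)
  then obtain x where x: "y = A *v x" using yz(1) by blast
  have "z \<bullet> (A *v (transpose A *v z)) = 0"
    using yz(2) by (simp add: orthogonal_def span_base)
  then have "transpose A *v z = 0"
    using inner_matrix_vector_transpose[of z A "transpose A *v z"] by simp
  then have "normal_solution A b x"
    unfolding normal_solution_def yz(3) x
    by (simp add: matrix_vector_right_distrib del: transpose_matrix_vector
        flip: matrix_vector_mul_assoc)
  then show ?thesis by (rule that)
qed

lemma normal_solution_least_squares:
  fixes A :: "real^'n^'m"
  assumes "normal_solution A b x"
  shows "least_squares_solution A b x"
proof -
  have res: "transpose A *v (b - A *v x) = 0"
    using assms unfolding normal_solution_def
    by (simp add: matrix_vector_mult_diff_distrib del: transpose_matrix_vector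
        flip: matrix_vector_mul_assoc)
  have "norm (b - A *v x) \<le> norm (b - A *v z)" for z
  proof -
    have "orthogonal (b - A *v x) (A *v (x - z))"
      using inner_matrix_vector_transpose[of "b - A *v x" A "x - z"] res
      by (simp add: orthogonal_def)
    then have "(norm (b - A *v x + A *v (x - z)))\<^sup>2
        = (norm (b - A *v x))\<^sup>2 + (norm (A *v (x - z)))\<^sup>2"
      by (rule norm_add_Pythagorean)
    then have "(norm (b - A *v x))\<^sup>2 \<le> (norm (b - A *v z))\<^sup>2"
      by (simp add: matrix_vector_mult_diff_distrib)
    then show ?thesis by (rule power2_le_imp_le) simp
  qed
  then show ?thesis
    unfolding least_squares_solution_def is_arg_min_def by (simp add: not_less)
qed

text \<open>\<open>C ** (transpose A ** A)\<close> is selfadjoint for the inner product given by the inverse of \<open>C\<close>,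
  so its range meets its kernel trivially.\<close>

lemma pos_def_gram_inj_on_range:
  fixes A :: "real^'n^'m"
  assumes C: "pos_def C"
  shows "inj_on (\<lambda>x. (C ** (transpose A ** A)) *v x)
    (range (\<lambda>x. (C ** (transpose A ** A)) *v x))"
proof -
  let ?G = "transpose A ** A"
  have "(C ** ?G) *v x = 0" if "(C ** ?G) *v ((C ** ?G) *v x) = 0" for x
  proof -
    let ?g = "?G *v x"
    have "?G *v (C *v ?g) = 0"
      using that pos_def_injective[OF C, of "?G *v (C *v ?g)"]
      by (simp add: matrix_vector_mul_assoc matrix_mul_assoc)
    \<comment> \<open>Moving \<open>?G\<close> to the left factor turns this into the quadratic form
      of \<open>C\<close> at \<open>?g\<close>.\<close>
    then have "x \<bullet> (?G *v (C *v ?g)) = 0" by simp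
    moreover have "transpose ?G = ?G" by (simp add: matrix_transpose_mul)
    ultimately have "?g \<bullet> (C *v ?g) = 0"
      using symmetric_matrix_inner by metis
    then have "?g = 0"
      using C unfolding pos_def_def by (metis less_irrefl)
    then show ?thesis by (simp flip: matrix_vector_mul_assoc)
  qed
  then show ?thesis
    by (subst linear_inj_on_iff_eq_0[OF matrix_vector_mul_linear])
      (auto intro: linear_subspace_image matrix_vector_mul_linear)
qed

text \<open>A maximal independent subset of all Krylov vectors is finite, so its indices lie below
  some \<open>k\<close>. The \<open>k\<close>th space then contains every Krylov vector, including
  the successor of its last generator, which gives invariance.\<close>

lemma krylov_stabilises:
  fixes A :: "real^'n^'m"
  obtains k where "\<And>x. x \<in> krylov A C s k \<Longrightarrow> (C ** (transpose A ** A)) *v x \<in> krylov A C s k"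
    "C *v s \<in> krylov A C s k"
proof -
  let ?T = "C ** (transpose A ** A)"
  define v where "v i = mat_pow ?T i *v (C *v s)" for i
  have kry: "krylov A C s k = span (v ` {..<k})" for k
    by (simp add: krylov_def v_def)
  obtain F where F: "F \<subseteq> range v" "independent F" "range v \<subseteq> span F"
    using maximal_independent_subset by blast
  then have "finite F" using finiteI_independent by blast
  then obtain I where I: "finite I" "F = v ` I"
    using finite_subset_image[of F v UNIV] F(1) by blast
  obtain k where "I \<subseteq> {..<k}"
    using finite_nat_bounded[OF I(1)] by blast
  then have "span F \<subseteq> krylov A C s k"
    unfolding kry I(2) by (intro span_mono image_mono)
  then have all: "v i \<in> krylov A C s k" for i
    using F(3) by blast
  have "?T *v x \<in> krylov A C s k" if "x \<in> krylov A C s k" for x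
  proof -
    have "?T *v x \<in> span ((\<lambda>x. ?T *v x) ` v ` {..<k})"
      using that linear_span_image[OF matrix_vector_mul_linear[of ?T]] unfolding kry by blast
    moreover have "?T *v v i = v (Suc i)" for i
      by (simp add: v_def matrix_vector_mul_assoc matrix_mul_assoc)
    then have "(\<lambda>x. ?T *v x) ` v ` {..<k} \<subseteq> krylov A C s k"
      using all by auto
    then have "span ((\<lambda>x. ?T *v x) ` v ` {..<k}) \<subseteq> krylov A C s k"
      unfolding kry by (simp add: span_minimal)
    ultimately show ?thesis by blast
  qed
  moreover have "C *v s \<in> krylov A C s k"
    using all[of 0] by (simp add: v_def)
  ultimately show ?thesis by (rule that)
qed

text \<open>For rank-deficient \<open>A\<close> the normal equations have many solutions; uniqueness
  holds only within the search space, by injectivity of \<open>C G\<close> on the Krylov space,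
  where \<open>G = A^T A\<close>.\<close>

lemma krylov_normal_solution:
  fixes A :: "real^'n^'m"
  assumes C: "pos_def C"
  obtains k x where "x \<in> search_space A C b x0 k" "normal_solution A b x"
    "\<forall>y\<in>search_space A C b x0 k. normal_solution A b y \<longrightarrow> y = x"
proof -
  let ?G = "transpose A ** A"
  let ?T = "\<lambda>x. (C ** ?G) *v x"
  define s where "s = transpose A *v (b - A *v x0)"
  have s: "s = transpose A *v b - ?G *v x0"
    by (simp add: s_def matrix_vector_mult_diff_distrib del: transpose_matrix_vector
        flip: matrix_vector_mul_assoc)
  obtain k where inv: "\<And>x. x \<in> krylov A C s k \<Longrightarrow> ?T x \<in> krylov A C s k"
    and Cs: "C *v s \<in> krylov A C s k"
    using krylov_stabilises by blast
  let ?K = "krylov A C s k"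
  have sub: "subspace ?K" by (simp add: krylov_def)
  have lin: "linear ?T" by (rule matrix_vector_mul_linear)
  \<comment> \<open>Powers \<open>i > 0\<close> have a leading factor \<open>C ** ?G\<close>. For
    \<open>i = 0\<close>, consistency of the normal equations is what puts \<open>C s\<close> into
    the range.\<close>
  have "?K \<subseteq> range ?T"
  proof -
    obtain u where "normal_solution A b u" by (rule normal_solution_exists)
    then have "s = ?G *v (u - x0)"
      by (simp add: s normal_solution_def matrix_vector_mult_diff_distrib)
    then have "C *v s = ?T (u - x0)" by (simp add: matrix_vector_mul_assoc)
    then have "mat_pow (C ** ?G) i *v (C *v s) \<in> range ?T" for i
      by (cases i) (auto simp flip: matrix_vector_mul_assoc)
    then show ?thesis
      unfolding krylov_def
      by (intro span_minimal linear_subspace_image[OF lin]) auto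
  qed
  then have inj: "inj_on ?T ?K"
    using pos_def_gram_inj_on_range[OF C] inj_on_subset by blast
  \<comment> \<open>An injective linear map of a finite-dimensional space into itself is
    onto.\<close>
  have "?T ` ?K = ?K"
  proof (rule subspace_dim_equal)
    show "dim ?K \<le> dim (?T ` ?K)"
      using dim_image_eq[OF lin, of ?K] inj sub by (simp add: span_eq_iff[THEN iffD2])
  qed (use inv sub linear_subspace_image[OF lin] in auto)
  then obtain d where d: "d \<in> ?K" "?T d = C *v s" using Cs by (metis imageE)
  \<comment> \<open>Multiplication by the injective \<open>C\<close> loses no information, so the
    preconditioned equation for the correction \<open>e\<close> is equivalent to the normal
    equations at \<open>x0 + e\<close>.\<close>
  have normal: "normal_solution A b (x0 + e) \<longleftrightarrow> ?T e = C *v s" for e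
  proof -
    have "?T e = C *v s \<longleftrightarrow> C *v (?G *v e - s) = 0"
      by (simp add: matrix_vector_mult_diff_distrib matrix_vector_mul_assoc)
    also have "\<dots> \<longleftrightarrow> ?G *v e - s = 0"
      by (metis matrix_vector_mult_0_right pos_def_injective[OF C])
    also have "\<dots> \<longleftrightarrow> normal_solution A b (x0 + e)"
      unfolding normal_solution_def s matrix_vector_right_distrib
      by (auto simp: algebra_simps simp del: transpose_matrix_vector)
    finally show ?thesis by simp
  qed
  show ?thesis
  proof (rule that)
    show "x0 + d \<in> search_space A C b x0 k"
      using d(1) unfolding search_space_def s_def by blast
    show "normal_solution A b (x0 + d)"
      unfolding normal by (rule d(2))
    show "\<forall>y\<in>search_space A C b x0 k. normal_solution A b y \<longrightarrow> y = x0 + d"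
    proof (intro ballI impI)
      fix y assume y: "y \<in> search_space A C b x0 k" "normal_solution A b y"
      obtain e where e: "e \<in> ?K" "y = x0 + e"
        using y(1) unfolding search_space_def s_def by blast
      have "?T e = ?T d"
        using y(2) unfolding e(2) normal d(2) .
      then have "e = d"
        by (rule inj_onD[OF inj _ e(1) d(1)])
      then show "y = x0 + d" using e(2) by simp
    qed
  qed
qed

section \<open>From minimising iterates to least-squares solutions\<close>

lemma is_arg_min_zero:
  fixes f :: "'a \<Rightarrow> real"
  assumes "P x" "f x = 0" "\<And>y. f y \<ge> 0"
  shows "is_arg_min f P y \<longleftrightarrow> P y \<and> f y = 0"
proof -
  have "f y = 0 \<longleftrightarrow> f y \<le> 0"
    using assms(3)[of y] by linarith
  moreover have "(\<forall>z. P z \<longrightarrow> f y \<le> f z) \<longleftrightarrow> f y \<le> 0"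
    using assms by (metis order_trans)
  ultimately show ?thesis
    unfolding is_arg_min_def by (auto simp: not_less)
qed

text \<open>The common frame of all three methods: iterates have to be identified with normal
  solutions only for those \<open>k\<close> whose search space contains one.\<close>

lemma determines_solution_if_normal_solution_iff:
  assumes C: "pos_def C"
    and iter: "\<And>k x y. x \<in> search_space A C b x0 k \<Longrightarrow> normal_solution A b x \<Longrightarrow>
      iterate k y \<longleftrightarrow> y \<in> search_space A C b x0 k \<and> normal_solution A b y"
  shows "determines_solution iterate A b"
proof -
  obtain k x where x: "x \<in> search_space A C b x0 k" "normal_solution A b x"
    "\<forall>y\<in>search_space A C b x0 k. normal_solution A b y \<longrightarrow> y = x"
    by (rule krylov_normal_solution[OF C])
  then show ?thesis
    unfolding determines_solution_def
    using iter[OF x(1,2)] normal_solution_least_squares[OF x(2)] x by blast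
qed

lemma normal_cg_determines_solution:
  assumes C: "pos_def C"
  shows "determines_solution (normal_cg_iterate A C b x0) A b"
proof (rule determines_solution_if_normal_solution_iff[OF C])
  fix k x y assume x: "x \<in> search_space A C b x0 k" "normal_solution A b x"
  \<comment> \<open>Two normal solutions differ by an element of the kernel of \<open>A\<close>, so
    the zeros of the objective do not depend on the reference solution \<open>xs\<close>.\<close>
  have diff: "norm (A *v (z - xs)) = 0 \<longleftrightarrow> normal_solution A b z" if "normal_solution A b xs" for z xs
    using that gram_eq_0_iff[of A "z - xs"]
    by (simp add: normal_solution_def matrix_vector_mult_diff_distrib)
  have "is_arg_min (\<lambda>y. norm (A *v (y - xs))) (\<lambda>y. y \<in> search_space A C b x0 k) y \<longleftrightarrow>
      y \<in> search_space A C b x0 k \<and> normal_solution A b y" if "normal_solution A b xs" for xs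
    using is_arg_min_zero[of "\<lambda>y. y \<in> search_space A C b x0 k" x "\<lambda>y. norm (A *v (y - xs))" y]
      x diff[OF that] by simp
  \<comment> \<open>The iterate predicate quantifies over all reference solutions; \<open>x\<close>
    itself is one, so the quantifier is not vacuous.\<close>
  then show "normal_cg_iterate A C b x0 k y \<longleftrightarrow>
      y \<in> search_space A C b x0 k \<and> normal_solution A b y"
    unfolding normal_cg_iterate_def using C x by blast
qed

lemma normal_minres_determines_solution:
  assumes C: "pos_def C"
  shows "determines_solution (normal_minres_iterate A C b x0) A b"
proof (rule determines_solution_if_normal_solution_iff[OF C])
  fix k x y assume x: "x \<in> search_space A C b x0 k" "normal_solution A b x"
  have res: "norm (mat_sqrt C *v (transpose A *v (b - A *v z))) = 0 \<longleftrightarrow> normal_solution A b z" for z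
  proof -
    have "norm (mat_sqrt C *v (transpose A *v (b - A *v z))) = 0
        \<longleftrightarrow> transpose A *v (b - A *v z) = 0"
      using pos_def_injective[OF pos_def_mat_sqrt[OF C]] by auto
    also have "\<dots> \<longleftrightarrow> normal_solution A b z"
      unfolding normal_solution_def
      by (auto simp: matrix_vector_mult_diff_distrib simp del: transpose_matrix_vector
          simp flip: matrix_vector_mul_assoc)
    finally show ?thesis .
  qed
  show "normal_minres_iterate A C b x0 k y \<longleftrightarrow>
      y \<in> search_space A C b x0 k \<and> normal_solution A b y"
    unfolding normal_minres_iterate_def
    using is_arg_min_zero[of "\<lambda>y. y \<in> search_space A C b x0 k" x
        "\<lambda>y. norm (mat_sqrt C *v (transpose A *v (b - A *v y)))" y] x C res by simp
qed

theorem theorem3p1: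
  fixes A :: "real^'n^'m" and M N H :: "real^'n^'n" and l :: nat
  assumes "transpose M = M"
    and "invertible M"
    and "transpose A ** A = M - N"
    and "l \<ge> 1"
    and "H = matrix_inv M ** N"
    and "odd l \<Longrightarrow> definite M"
    and "even l \<Longrightarrow> definite (M + N)"
  shows "\<forall>b x0.
      determines_solution (cgls_iterate A (preconditioner (inner_matrix H M l)) b x0) A b \<and>
      determines_solution (lsqr_iterate A (preconditioner (inner_matrix H M l)) b x0) A b \<and>
      determines_solution (lsmr_iterate A (preconditioner (inner_matrix H M l)) b x0) A b"
proof -
  \<comment> \<open>Symmetry of \<open>N\<close> is inherited from \<open>M\<close> and the Gram
    matrix.\<close>
  have "N = M + - (transpose A ** A)" using assms(3) by simp
  then have "transpose N = N"
    by (simp only: transpose_add transpose_minus matrix_transpose_mul transpose_transpose assms(1))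
  then have C: "pos_def (preconditioner (inner_matrix H M l))"
    using assms by (intro pos_def_preconditioner_inner_matrix[of M N])
  show ?thesis
    using normal_cg_determines_solution[OF C, where A = A]
      normal_minres_determines_solution[OF C, where A = A]
    by (simp add: determines_solution_def cgls_iterate_def lsqr_iterate_def lsmr_iterate_def)
qed

end
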